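(* Endow $\ell_2$ with the Hilbert $L$-norm, i.e. identify $H\ell_2$ with $H\otimes_{hil}\ell_2$ as a normed space. Let $n\in\mathbb{N}$, let $\mathbf{p}^m\in\ell_2$ ($m=1,2,\dots$) be the sequence with $1$ in the $m$-th place and $0$ elsewhere, let $e_1,e_2,\dots$ be an orthonormal system in $H$, and set $$V:=\sum_{k=1}^ne_k(\mathbf{p}^k\otimes\mathbf{p}^k)\in H(\ell_2\otimes\ell_2).$$ Then $\|V\|_{pl}=n$, where $\|\cdot\|_{pl}$ is the norm on $H(\ell_2\otimes\ell_2)$ of the $PL$-space $\ell_2\otimes_{pl}\ell_2$.
   Context: All linear spaces are complex. $H$ is a fixed separable infinite-dimensional Hilbert space, $\mathcal{B}$ is the algebra of bounded operators on $H$ with the operator norm. For a linear space $E$, $HE:=H\otimes E$ (algebraic tensor product), with elementary tensors written $\xi x$; it is a left $\mathcal{B}$-module via $a\cdot(\xi x):=a(\xi)x$. A $PL$-space is a linear space $E$ together with a norm on $HE$ such that $\|a\cdot u\|\le\|a\|\|u\|$ for all $a\in\mathcal{B}$, $u\in HE$. $\otimes_{hil}$ denotes the non-completed Hilbert tensor product. Fix a unitary isomorphism $\iota$ from the Hilbert tensor product $H\widehat\otimes_{hil}H$ onto $H$, and put $\xi\diamondsuit\eta:=\iota(\xi\otimes\eta)$. For $u\in HE$, $v\in HF$ the element $u\diamondsuit v\in H(E\otimes F)$ is well defined bilinearly by $\xi x\diamondsuit\eta y:=(\xi\diamondsuit\eta)(x\otimes y)$. For $PL$-spaces $E,F$, $E\otimes_{pl}F$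 is the $PL$-space $E\otimes F$ with the norm on $H(E\otimes F)$ $$\|U\|_{pl}:=\inf\Big\{\sum_{k=1}^m\|a_k\|\|u_k\|\|v_k\|\Big\},$$ the infimum being over all representations $U=\sum_{k=1}^m a_k\cdot(u_k\diamondsuit v_k)$ with $m\in\mathbb{N}$, $a_k\in\mathcal{B}$, $u_k\in HE$, $v_k\in HF$. *)

theory Defs
  imports "HOL-Analysis.Analysis" "HOL-Library.Poly_Mapping"
begin

section \<open>Complex linear spaces and Hilbert spaces\<close>

class complex_vector = ab_group_add +
  fixes scaleC :: "complex \<Rightarrow> 'a \<Rightarrow> 'a"  (infixr \<open>*\<^sub>C\<close> 75)
  assumes scaleC_add_right: "c *\<^sub>C (x + y) = c *\<^sub>C x + c *\<^sub>C y"
    and scaleC_add_left: "(c + d) *\<^sub>C x = c *\<^sub>C x + d *\<^sub>C x"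
    and scaleC_scaleC: "c *\<^sub>C d *\<^sub>C x = (c * d) *\<^sub>C x"
    and scaleC_one: "1 *\<^sub>C x = x"

interpretation complex_vector: vector_space "scaleC :: complex \<Rightarrow> 'a \<Rightarrow> 'a::complex_vector"
  by unfold_locales (rule scaleC_add_right scaleC_add_left scaleC_scaleC scaleC_one)+

abbreviation clinear :: "('a::complex_vector \<Rightarrow> 'b::complex_vector) \<Rightarrow> bool"
  where "clinear \<equiv> Vector_Spaces.linear (*\<^sub>C) (*\<^sub>C)"

definition cbilinear ::
    "('a::complex_vector \<Rightarrow> 'b::complex_vector \<Rightarrow> 'c::complex_vector) \<Rightarrow> bool"
  where "cbilinear \<beta> \<longleftrightarrow> (\<forall>x. clinear (\<beta> x)) \<and> (\<forall>y. clinear (\<lambda>x. \<beta> x y))"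

instantiation complex :: complex_vector
begin
definition scaleC_complex :: "complex \<Rightarrow> complex \<Rightarrow> complex"
  where "scaleC_complex c z = c * z"
instance
  by standard (simp_all add: scaleC_complex_def algebra_simps)
end

text \<open>Inner products are linear in the first and conjugate-linear in the second argument.\<close>

class complex_inner = complex_vector +
  fixes cinner :: "'a \<Rightarrow> 'a \<Rightarrow> complex"
  assumes cinner_commute: "cinner x y = cnj (cinner y x)"
    and cinner_add_left: "cinner (x + y) z = cinner x z + cinner y z"
    and cinner_scaleC_left: "cinner (c *\<^sub>C x) y = c * cinner x y"
    and cinner_ge_zero: "0 \<le> Re (cinner x x)"
    and cinner_eq_zero_imp: "cinner x x = 0 \<Longrightarrow> x = 0"

definition cinner_norm :: "'a::complex_inner \<Rightarrow> real"
  where "cinner_norm x = sqrt (Re (cinner x x))"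

class chilbert_space = complex_inner + banach +
  assumes scaleR_scaleC: "scaleR r x = complex_of_real r *\<^sub>C x"
    and norm_eq_sqrt_cinner: "norm x = sqrt (Re (cinner x x))"

definition bounded_clinear :: "('a::chilbert_space \<Rightarrow> 'b::chilbert_space) \<Rightarrow> bool"
  where "bounded_clinear a \<longleftrightarrow> clinear a \<and> bounded_linear a"

definition unitary_map :: "('a::complex_inner \<Rightarrow> 'b::complex_inner) \<Rightarrow> bool"
  where "unitary_map f \<longleftrightarrow>
    clinear f \<and> bij f \<and> (\<forall>x y. cinner (f x) (f y) = cinner x y)"

text \<open>A completion of an inner product space is a Hilbert space together with a linear isometric
  embedding onto a dense subspace.\<close>

definition hilbert_completion :: "('a::complex_inner \<Rightarrow> 'k::chilbert_space) \<Rightarrow> bool"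
  where "hilbert_completion j \<longleftrightarrow>
    clinear j \<and> (\<forall>x y. cinner (j x) (j y) = cinner x y) \<and> closure (range j) = UNIV"

lemma clinearI:
  assumes "\<And>x y. f (x + y) = f x + f y" "\<And>c x. f (c *\<^sub>C x) = c *\<^sub>C f x"
  shows "clinear f"
  using assms by unfold_locales auto

lemma clinear_add: "clinear f \<Longrightarrow> f (x + y) = f x + f y"
  and clinear_scaleC: "clinear f \<Longrightarrow> f (c *\<^sub>C x) = c *\<^sub>C f x"
  by (simp_all add: Vector_Spaces.linear_iff)

lemma clinear_zero: "clinear f \<Longrightarrow> f 0 = 0"
  using clinear_scaleC[of f 0 0] by simp

lemma clinear_sum: "clinear f \<Longrightarrow> f (sum g A) = (\<Sum>i\<in>A. f (g i))"
  by (induction A rule: infinite_finite_induct) (auto simp: clinear_zero clinear_add)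

lemma cbilinearI:
  assumes "\<And>x x' y. \<beta> (x + x') y = \<beta> x y + \<beta> x' y" "\<And>x y y'. \<beta> x (y + y') = \<beta> x y + \<beta> x y'"
    "\<And>c x y. \<beta> (c *\<^sub>C x) y = c *\<^sub>C \<beta> x y" "\<And>c x y. \<beta> x (c *\<^sub>C y) = c *\<^sub>C \<beta> x y"
  shows "cbilinear \<beta>"
  unfolding cbilinear_def by (auto intro!: clinearI simp: assms)

lemma cinner_zero_left [simp]: "cinner 0 (y::'a::complex_inner) = 0"
  using cinner_scaleC_left[of 0 0 y] by simp

lemma cinner_zero_right [simp]: "cinner (y::'a::complex_inner) 0 = 0"
  using cinner_commute[of y 0] by simp

lemma cinner_add_right: "cinner (x::'a::complex_inner) (y + z) = cinner x y + cinner x z"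
  by (metis cinner_add_left cinner_commute complex_cnj_add)

lemma cinner_scaleC_right: "cinner (x::'a::complex_inner) (c *\<^sub>C y) = cnj c * cinner x y"
  by (metis cinner_commute cinner_scaleC_left complex_cnj_mult)

lemma cinner_sum_left: "cinner (sum f A) (y::'a::complex_inner) = (\<Sum>i\<in>A. cinner (f i) y)"
  by (induction A rule: infinite_finite_induct) (auto simp: cinner_add_left)

lemma cinner_sum_right: "cinner (y::'a::complex_inner) (sum f A) = (\<Sum>i\<in>A. cinner y (f i))"
  by (induction A rule: infinite_finite_induct) (auto simp: cinner_add_right)

lemma cinner_self: "cinner x x = complex_of_real (Re (cinner (x::'a::complex_inner) x))"
  using cinner_commute[of x x] by (simp add: complex_eq_iff)

section \<open>The algebraic tensor product\<close>

text \<open>The tensor product is the free linear space on pairs, realised by finitely supported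
  functions, modulo the span of the bilinearity relations.\<close>

definition free_scale :: "complex \<Rightarrow> ('k \<Rightarrow>\<^sub>0 complex) \<Rightarrow> ('k \<Rightarrow>\<^sub>0 complex)"
  where "free_scale c p = Poly_Mapping.map ((*) c) p"

lemma lookup_free_scale [simp]:
  "Poly_Mapping.lookup (free_scale c p) k = c * Poly_Mapping.lookup p k"
  by (simp add: free_scale_def Poly_Mapping.map.rep_eq when_def)

interpretation free_space: vector_space free_scale
  by unfold_locales (auto intro!: poly_mapping_eqI simp: lookup_add algebra_simps)

abbreviation free_gen :: "'a \<Rightarrow> 'b \<Rightarrow> ('a \<times> 'b) \<Rightarrow>\<^sub>0 complex"
  where "free_gen x y \<equiv> Poly_Mapping.single (x, y) 1"

definition bilinearity_relations ::
    "(('a::complex_vector \<times> 'b::complex_vector) \<Rightarrow>\<^sub>0 complex) set"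
  where "bilinearity_relations =
      {free_gen (x + x') y - free_gen x y - free_gen x' y | x x' y. True}
    \<union> {free_gen x (y + y') - free_gen x y - free_gen x y' | x y y'. True}
    \<union> {free_gen (c *\<^sub>C x) y - free_scale c (free_gen x y) | c x y. True}
    \<union> {free_gen x (c *\<^sub>C y) - free_scale c (free_gen x y) | c x y. True}"

definition tensor_eq ::
    "(('a::complex_vector \<times> 'b::complex_vector) \<Rightarrow>\<^sub>0 complex) \<Rightarrow> ('a \<times> 'b \<Rightarrow>\<^sub>0 complex) \<Rightarrow> bool"
  where "tensor_eq p q \<longleftrightarrow> p - q \<in> free_space.span bilinearity_relations"

lemma equivp_tensor_eq:
  "equivp (tensor_eq :: (('a::complex_vector \<times> 'b::complex_vector) \<Rightarrow>\<^sub>0 complex) \<Rightarrow> _)"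
  (is "equivp ?R")
proof (rule equivpI)
  show "reflp ?R" by (auto intro!: reflpI simp: tensor_eq_def free_space.span_zero)
  show "symp ?R"
  proof (rule sympI)
    fix p q :: "('a \<times> 'b) \<Rightarrow>\<^sub>0 complex"
    assume "tensor_eq p q"
    then show "?R q p"
      unfolding tensor_eq_def using free_space.span_neg[of "p - q"] by simp
  qed
  show "transp ?R"
  proof (rule transpI)
    fix p q r :: "('a \<times> 'b) \<Rightarrow>\<^sub>0 complex"
    assume "tensor_eq p q" "tensor_eq q r"
    then show "?R p r"
      unfolding tensor_eq_def using free_space.span_add[of "p - q" _ "q - r"] by simp
  qed
qed

quotient_type (overloaded) ('a, 'b) tensor =
    "('a::complex_vector \<times> 'b::complex_vector) \<Rightarrow>\<^sub>0 complex" / tensor_eq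
  by (rule equivp_tensor_eq)

instantiation tensor :: (complex_vector, complex_vector) complex_vector
begin

lift_definition zero_tensor :: "('a, 'b) tensor" is 0 .

lift_definition plus_tensor :: "('a, 'b) tensor \<Rightarrow> ('a, 'b) tensor \<Rightarrow> ('a, 'b) tensor"
  is "(+)"
  unfolding tensor_eq_def by (metis add_diff_add free_space.span_add)

lift_definition minus_tensor :: "('a, 'b) tensor \<Rightarrow> ('a, 'b) tensor \<Rightarrow> ('a, 'b) tensor"
  is "(-)"
proof -
  fix p q p' q' :: "('a \<times> 'b) \<Rightarrow>\<^sub>0 complex"
  assume "tensor_eq p q" "tensor_eq p' q'"
  moreover have "p - p' - (q - q') = (p - q) - (p' - q')" by simp
  ultimately show "tensor_eq (p - p') (q - q')"
    unfolding tensor_eq_def by (metis free_space.span_diff)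
qed

lift_definition uminus_tensor :: "('a, 'b) tensor \<Rightarrow> ('a, 'b) tensor" is "uminus"
  unfolding tensor_eq_def
  by (metis free_space.span_neg minus_diff_minus)

lift_definition scaleC_tensor :: "complex \<Rightarrow> ('a, 'b) tensor \<Rightarrow> ('a, 'b) tensor" is free_scale
  unfolding tensor_eq_def
  by (metis free_space.scale_right_diff_distrib free_space.span_scale)

instance
proof
  fix a b x :: "('a, 'b) tensor" and c d :: complex
  have refl: "tensor_eq p p" for p :: "('a \<times> 'b) \<Rightarrow>\<^sub>0 complex"
    by (simp add: tensor_eq_def free_space.span_zero)
  note ac = refl algebra_simps
  show "a + b + x = a + (b + x)" by transfer (simp add: ac)
  show "a + b = b + a" by transfer (simp add: ac)
  show "0 + a = a" by transfer (simp add: ac)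
  show "- a + a = 0" by transfer (simp add: ac)
  show "a - b = a + - b" by transfer (simp add: ac)
  show "c *\<^sub>C (a + b) = c *\<^sub>C a + c *\<^sub>C b"
    by transfer (simp only: free_space.scale_right_distrib refl)
  show "(c + d) *\<^sub>C a = c *\<^sub>C a + d *\<^sub>C a"
    by transfer (simp only: free_space.scale_left_distrib refl)
  show "c *\<^sub>C d *\<^sub>C a = (c * d) *\<^sub>C a" by transfer (simp only: free_space.scale_scale refl)
  show "1 *\<^sub>C a = a" by transfer (simp only: free_space.scale_one refl)
qed

end

lift_definition pure_tensor ::
    "'a::complex_vector \<Rightarrow> 'b::complex_vector \<Rightarrow> ('a, 'b) tensor"  (infixr \<open>\<otimes>\<close> 80)
  is free_gen .

lemma tensor_eq_relation: "p - q \<in> bilinearity_relations \<Longrightarrow> tensor_eq p q"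
  by (simp add: tensor_eq_def free_space.span_base)

lemma tensor_add_left: "(x + x') \<otimes> y = x \<otimes> y + x' \<otimes> y"
  and tensor_add_right: "x \<otimes> (y + y') = x \<otimes> y + x \<otimes> y'"
  and tensor_scaleC_left: "(c *\<^sub>C x) \<otimes> y = c *\<^sub>C (x \<otimes> y)"
  and tensor_scaleC_right: "x \<otimes> (c *\<^sub>C y) = c *\<^sub>C (x \<otimes> y)"
  by (transfer, rule tensor_eq_relation, unfold bilinearity_relations_def diff_diff_add[symmetric],
      blast)+

lemma tensor_zero_left [simp]: "0 \<otimes> y = 0"
  using tensor_scaleC_left[of 0 0 y] by simp

lemma tensor_zero_right [simp]: "x \<otimes> 0 = 0"
  using tensor_scaleC_right[of x 0 0] by simp

lemma cbilinear_pure_tensor: "cbilinear (\<otimes>)"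
  by (intro cbilinearI) (simp_all add: tensor_add_left tensor_add_right tensor_scaleC_left
      tensor_scaleC_right)

lemma cbilinear_pure_tensor_flip: "cbilinear (\<lambda>x y. y \<otimes> x)"
  by (intro cbilinearI) (simp_all add: tensor_add_left tensor_add_right tensor_scaleC_left
      tensor_scaleC_right)

lemma tensor_induct [case_names zero add]:
  assumes "P 0" and step: "\<And>u x y. P u \<Longrightarrow> P (u + x \<otimes> y)"
  shows "P (u :: ('a::complex_vector, 'b::complex_vector) tensor)"
proof -
  have gen: "abs_tensor (Poly_Mapping.single k c) = (c *\<^sub>C fst k) \<otimes> snd k"
    for k :: "'a \<times> 'b" and c
  proof -
    have "Poly_Mapping.single k c = free_scale c (free_gen (fst k) (snd k))"
      by (auto intro!: poly_mapping_eqI simp: lookup_single when_def)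
    then show ?thesis
      by (subst tensor_scaleC_left) (simp only: scaleC_tensor.abs_eq pure_tensor.abs_eq)
  qed
  have "P (abs_tensor p)" for p
  proof (induction p rule: update_induct)
    case const
    then show ?case using assms(1) by (simp add: zero_tensor_def)
  next
    case (update f k v)
    have "Poly_Mapping.update k v f = f + Poly_Mapping.single k v"
      using update(1) by (auto intro!: poly_mapping_eqI
          simp: lookup_add lookup_update lookup_single when_def in_keys_iff)
    then show ?case
      using step[OF update(3)] by (simp add: plus_tensor.abs_eq[symmetric] gen)
  qed
  then show ?thesis by (metis Quotient3_abs_rep Quotient3_tensor)
qed

text \<open>The linear map on the tensor product induced by a bilinear map.\<close>

definition tensor_lift ::
    "('a::complex_vector \<Rightarrow> 'b::complex_vector \<Rightarrow> 'c::complex_vector) \<Rightarrow> ('a, 'b) tensor \<Rightarrow> 'c"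
  where "tensor_lift \<beta> = (THE f. clinear f \<and> (\<forall>x y. f (x \<otimes> y) = \<beta> x y))"

lemma tensor_linear_eq:
  assumes "clinear f" "clinear g" "\<And>x y. f (x \<otimes> y) = g (x \<otimes> y)"
  shows "f u = g u"
  by (induction u rule: tensor_induct) (simp_all add: clinear_zero clinear_add assms)

lemma tensor_universal:
  fixes \<beta> :: "'a::complex_vector \<Rightarrow> 'b::complex_vector \<Rightarrow> 'c::complex_vector"
  assumes "cbilinear \<beta>"
  shows "\<exists>!f. clinear f \<and> (\<forall>x y. f (x \<otimes> y) = \<beta> x y)"
proof (rule ex_ex1I)
  define b where "b k = \<beta> (fst k) (snd k)" for k
  define g where "g p = (\<Sum>k\<in>Poly_Mapping.keys p. Poly_Mapping.lookup p k *\<^sub>C b k)" for p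
  have g_eq: "g p = (\<Sum>k\<in>S. Poly_Mapping.lookup p k *\<^sub>C b k)"
    if "finite S" "Poly_Mapping.keys p \<subseteq> S" for p S
    unfolding g_def using that by (intro sum.mono_neutral_left) (auto simp: in_keys_iff)
  have g_add: "g (p + q) = g p + g q" for p q
  proof -
    let ?S = "Poly_Mapping.keys p \<union> Poly_Mapping.keys q"
    have "Poly_Mapping.keys (p + q) \<subseteq> ?S" by (rule Poly_Mapping.keys_add)
    then show ?thesis
      by (simp add: g_eq[of ?S] lookup_add complex_vector.scale_left_distrib sum.distrib)
  qed
  have g_scale: "g (free_scale c p) = c *\<^sub>C g p" for c p
  proof -
    have "Poly_Mapping.keys (free_scale c p) \<subseteq> Poly_Mapping.keys p"
      by (auto simp: in_keys_iff)
    then show ?thesis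
      by (simp add: g_eq[of "Poly_Mapping.keys p"] complex_vector.scale_sum_right)
  qed
  have g_diff: "g (p - q) = g p - g q" for p q
    using g_add[of "p - q" q] by simp
  have g_gen: "g (free_gen x y) = \<beta> x y" for x y
    by (simp add: g_def b_def)
  have g_zero: "g 0 = 0" by (simp add: g_def)
  have lin: "clinear (\<beta> x)" "clinear (\<lambda>x. \<beta> x y)" for x y
    using assms by (auto simp: cbilinear_def)
  have rel: "g p = 0" if "p \<in> bilinearity_relations" for p
    using that unfolding bilinearity_relations_def
    by (auto simp: g_diff g_gen g_scale clinear_add[OF lin(1)] clinear_add[OF lin(2)]
        clinear_scaleC[OF lin(1)] clinear_scaleC[OF lin(2)])
  have "g p = 0" if "p \<in> free_space.span bilinearity_relations" for p
    using that
    by (induction rule: free_space.span_induct_alt) (simp_all add: g_zero g_add g_scale rel)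
  then have cong: "g p = g q" if "tensor_eq p q" for p q
    using that by (fastforce simp: tensor_eq_def g_diff)
  define f where "f u = g (rep_tensor u)" for u
  have f_abs: "f (abs_tensor p) = g p" for p
    unfolding f_def by (rule cong) (metis Quotient3_tensor rep_abs_rsp_left equivp_reflp equivp_tensor_eq)
  have "clinear f"
  proof (rule clinearI)
    fix u v :: "('a, 'b) tensor" and c
    obtain p q where [simp]: "u = abs_tensor p" "v = abs_tensor q"
      by (metis Quotient3_abs_rep Quotient3_tensor)
    show "f (u + v) = f u + f v" by (simp add: plus_tensor.abs_eq f_abs g_add)
    show "f (c *\<^sub>C u) = c *\<^sub>C f u" by (simp add: scaleC_tensor.abs_eq f_abs g_scale)
  qed
  moreover have "f (x \<otimes> y) = \<beta> x y" for x y
    by (simp add: pure_tensor.abs_eq f_abs g_gen)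
  ultimately show "\<exists>f. clinear f \<and> (\<forall>x y. f (x \<otimes> y) = \<beta> x y)" by blast
next
  fix f g :: "('a, 'b) tensor \<Rightarrow> 'c"
  assume "clinear f \<and> (\<forall>x y. f (x \<otimes> y) = \<beta> x y)"
    and "clinear g \<and> (\<forall>x y. g (x \<otimes> y) = \<beta> x y)"
  then show "f = g" using tensor_linear_eq[of f g] by fastforce
qed

lemma tensor_lift:
  assumes "cbilinear \<beta>"
  shows clinear_tensor_lift: "clinear (tensor_lift \<beta>)"
    and tensor_lift_pure: "tensor_lift \<beta> (x \<otimes> y) = \<beta> x y"
  using theI'[OF tensor_universal[OF assms]] by (auto simp: tensor_lift_def)

lemma orthonormal_representation:
  fixes u :: "('a::complex_inner, 'b::complex_vector) tensor"
  obtains r :: nat and f :: "nat \<Rightarrow> 'a" and x :: "nat \<Rightarrow> 'b"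
  where "\<And>i k. i < r \<Longrightarrow> k < r \<Longrightarrow> cinner (f i) (f k) = (if i = k then 1 else 0)"
    and "u = (\<Sum>i<r. f i \<otimes> x i)"
proof -
  have "\<exists>r f x. (\<forall>i<r. \<forall>k<r. cinner (f i) (f k) = (if i = k then 1 else 0)) \<and>
      u = (\<Sum>i<r::nat. f i \<otimes> x i)"
  proof (induction u rule: tensor_induct)
    case zero
    show ?case by (intro exI[of _ 0]) simp
  next
    case (add u y z)
    then obtain r :: nat and f :: "nat \<Rightarrow> 'a" and x :: "nat \<Rightarrow> 'b"
      where on: "\<And>i k. i < r \<Longrightarrow> k < r \<Longrightarrow> cinner (f i) (f k) = (if i = k then 1 else 0)"
        and u: "u = (\<Sum>i<r. f i \<otimes> x i)" by blast
    define c where "c i = cinner y (f i)" for i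
    define w where "w = y - (\<Sum>i<r. c i *\<^sub>C f i)"
    have y: "y = (\<Sum>i<r. c i *\<^sub>C f i) + w" by (simp add: w_def)
    have orth: "cinner w (f k) = 0" if "k < r" for k
    proof -
      have "cinner y (f k) = (\<Sum>i<r. c i * cinner (f i) (f k)) + cinner w (f k)"
        by (subst y) (simp add: cinner_add_left cinner_sum_left cinner_scaleC_left)
      also have "(\<Sum>i<r. c i * cinner (f i) (f k)) = (\<Sum>i<r. if i = k then c i else 0)"
        using that by (intro sum.cong) (auto simp: on)
      also have "\<dots> = c k" using that by simp
      finally show ?thesis by (simp add: c_def)
    qed
    have orth': "cinner (f k) w = 0" if "k < r" for k
      using orth[OF that] cinner_commute[of "f k" w] by simp
    have yz: "y \<otimes> z = (\<Sum>i<r. f i \<otimes> (c i *\<^sub>C z)) + w \<otimes> z"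
    proof -
      have "clinear (\<lambda>v. v \<otimes> z)" using cbilinear_pure_tensor by (auto simp: cbilinear_def)
      then have "(\<Sum>i<r. c i *\<^sub>C f i) \<otimes> z = (\<Sum>i<r. (c i *\<^sub>C f i) \<otimes> z)"
        by (rule clinear_sum)
      then show ?thesis
        by (subst y) (simp add: tensor_add_left tensor_scaleC_left tensor_scaleC_right)
    qed
    have sum: "u + y \<otimes> z = (\<Sum>i<r. f i \<otimes> (x i + c i *\<^sub>C z)) + w \<otimes> z"
      by (simp add: u yz tensor_add_right sum.distrib)
    show ?case
    proof (cases "w = 0")
      case True
      show ?thesis using sum True on
        by (intro exI[of _ r] exI[of _ f] exI[of _ "\<lambda>i. x i + c i *\<^sub>C z"]) auto
    next
      case False
      define \<rho> where "\<rho> = sqrt (Re (cinner w w))"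
      have "cinner w w \<noteq> 0" using False cinner_eq_zero_imp by blast
      then have "Re (cinner w w) \<noteq> 0" using cinner_self[of w] by auto
      then have pos: "\<rho> > 0" using cinner_ge_zero[of w] by (simp add: \<rho>_def)
      have ww: "cinner w w = of_real \<rho> * of_real \<rho>"
        using cinner_self[of w] cinner_ge_zero[of w]
        by (metis \<rho>_def of_real_mult real_sqrt_mult_self abs_of_nonneg)
      define g where "g i = (if i < r then f i else (1 / of_real \<rho>) *\<^sub>C w)" for i
      define v where "v i = (if i < r then x i + c i *\<^sub>C z else of_real \<rho> *\<^sub>C z)" for i
      have "cinner (g i) (g k) = (if i = k then 1 else 0)" if "i < Suc r" "k < Suc r" for i k
        using that pos
        by (auto simp: g_def on orth orth' cinner_scaleC_left cinner_scaleC_right ww)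
      moreover have "u + y \<otimes> z = (\<Sum>i<Suc r. g i \<otimes> v i)"
      proof -
        have "g r \<otimes> v r = w \<otimes> z"
          using pos by (simp add: g_def v_def tensor_scaleC_left tensor_scaleC_right)
        then show ?thesis by (simp add: sum g_def v_def)
      qed
      ultimately show ?thesis by blast
    qed
  qed
  then show thesis using that by blast
qed

section \<open>The Hilbert tensor product (not completed)\<close>

text \<open>The sesquilinear form determined by
  \<open>\<langle>x \<otimes> y, x' \<otimes> y'\<rangle> = \<langle>x, x'\<rangle> \<langle>y, y'\<rangle>\<close>; the conjugation
  makes the outer argument of \<^const>\<open>tensor_lift\<close> bilinear.\<close>

instantiation tensor :: (complex_inner, complex_inner) complex_inner
begin

definition cinner_tensor :: "('a, 'b) tensor \<Rightarrow> ('a, 'b) tensor \<Rightarrow> complex"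
  where "cinner_tensor u v =
    tensor_lift (\<lambda>x y. cnj (tensor_lift (\<lambda>x' y'. cinner x' x * cinner y' y) v)) u"

context
begin

private lemma bil_inner: "cbilinear (\<lambda>x' y'. cinner x' (x::'a) * cinner y' (y::'b))"
  by (intro cbilinearI)
    (simp_all add: cinner_add_left cinner_scaleC_left scaleC_complex_def algebra_simps)

private lemma inner_arg:
  fixes v :: "('a, 'b) tensor"
  defines "L \<equiv> \<lambda>x y. tensor_lift (\<lambda>x' y'. cinner x' x * cinner y' y) v"
  shows "L (x + x') y = L x y + L x' y" "L x (y + y') = L x y + L x y'"
    "L (c *\<^sub>C x) y = cnj c * L x y" "L x (c *\<^sub>C y) = cnj c * L x y"
  unfolding L_def
  by (induction v rule: tensor_induct,
    simp_all only: clinear_zero[OF clinear_tensor_lift[OF bil_inner]]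
      clinear_add[OF clinear_tensor_lift[OF bil_inner]] tensor_lift_pure[OF bil_inner])
    (simp_all add: cinner_add_right cinner_scaleC_right algebra_simps)

private lemma bil_outer:
  "cbilinear (\<lambda>(x::'a) (y::'b). cnj (tensor_lift (\<lambda>x' y'. cinner x' x * cinner y' y) v))"
  by (intro cbilinearI) (simp_all add: inner_arg scaleC_complex_def)

private lemma T_linear: "clinear (\<lambda>u::('a, 'b) tensor. cinner u v)"
  unfolding cinner_tensor_def by (rule clinear_tensor_lift[OF bil_outer])

private lemma T_pure_left:
  "cinner ((x::'a) \<otimes> (y::'b)) v = cnj (tensor_lift (\<lambda>x' y'. cinner x' x * cinner y' y) v)"
  unfolding cinner_tensor_def by (rule tensor_lift_pure[OF bil_outer])

lemma cinner_pure_tensor: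
  "cinner ((x::'a) \<otimes> (y::'b)) (x' \<otimes> y') = cinner x x' * cinner y y'"
  by (simp add: T_pure_left tensor_lift_pure[OF bil_inner] cinner_commute[symmetric])

private lemma T_add_right:
  "cinner (u::('a, 'b) tensor) (v + v') = cinner u v + cinner u v'"
  by (induction u rule: tensor_induct)
    (simp_all add: clinear_zero[OF T_linear] clinear_add[OF T_linear] T_pure_left
      clinear_add[OF clinear_tensor_lift[OF bil_inner]])

private lemma T_zero_right: "cinner (u::('a, 'b) tensor) 0 = 0"
  using T_add_right[of u 0 0] by simp

private lemma T_pure_commute:
  "cinner (u::('a, 'b) tensor) (x \<otimes> y) = cnj (cinner (x \<otimes> y) u)"
  by (induction u rule: tensor_induct)
    (simp_all add: clinear_zero[OF T_linear] clinear_add[OF T_linear] T_zero_right T_add_right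
      cinner_pure_tensor cinner_commute[symmetric])

private lemma T_commute: "cinner (u::('a, 'b) tensor) v = cnj (cinner v u)"
  by (induction v rule: tensor_induct)
    (simp_all add: clinear_zero[OF T_linear] clinear_add[OF T_linear] T_zero_right T_add_right
      T_pure_commute)

private lemma T_sum_right:
  "cinner (u::('a, 'b) tensor) (\<Sum>i\<in>A. g i) = (\<Sum>i\<in>A. cinner u (g i))"
  by (induction A rule: infinite_finite_induct) (simp_all add: T_zero_right T_add_right)

private lemma T_orthonormal:
  assumes "\<And>i k. i < r \<Longrightarrow> k < r \<Longrightarrow> cinner (f i) (f k) = (if i = k then 1 else 0)"
  shows "cinner (\<Sum>i<r::nat. (f i::'a) \<otimes> (x i::'b)) (\<Sum>i<r. f i \<otimes> x i) =
    (\<Sum>i<r. cinner (x i) (x i))"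
proof -
  have "cinner (\<Sum>i<r. f i \<otimes> x i) (\<Sum>i<r. f i \<otimes> x i) =
      (\<Sum>k<r. \<Sum>i<r. cinner (f i) (f k) * cinner (x i) (x k))"
    by (simp add: T_sum_right clinear_sum[OF T_linear] cinner_pure_tensor)
  also have "\<dots> = (\<Sum>k<r. \<Sum>i<r. if i = k then cinner (x i) (x k) else 0)"
    using assms by (intro sum.cong refl) auto
  also have "\<dots> = (\<Sum>k<r. cinner (x k) (x k))"
    by (intro sum.cong refl) simp
  finally show ?thesis .
qed

instance
proof
  fix u v w :: "('a, 'b) tensor" and c :: complex
  show "cinner u v = cnj (cinner v u)" by (rule T_commute)
  show "cinner (u + v) w = cinner u w + cinner v w" by (rule clinear_add[OF T_linear])
  show "cinner (c *\<^sub>C u) v = c * cinner u v"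
    using clinear_scaleC[OF T_linear, of c u v] by (simp add: scaleC_complex_def)
  obtain r :: nat and f :: "nat \<Rightarrow> 'a" and x :: "nat \<Rightarrow> 'b"
    where on: "\<And>i k. i < r \<Longrightarrow> k < r \<Longrightarrow> cinner (f i) (f k) = (if i = k then 1 else 0)"
      and u: "u = (\<Sum>i<r. f i \<otimes> x i)"
    using orthonormal_representation[of u] by blast
  have uu: "cinner u u = (\<Sum>i<r. cinner (x i) (x i))"
    unfolding u by (rule T_orthonormal[OF on])
  show "0 \<le> Re (cinner u u)" by (simp add: uu sum_nonneg cinner_ge_zero)
  show "u = 0" if "cinner u u = 0"
  proof -
    have "(\<Sum>i<r. Re (cinner (x i) (x i))) = 0" using that uu by (metis Re_sum zero_complex.sel(1))
    then have "\<forall>i<r. Re (cinner (x i) (x i)) = 0"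
      by (subst (asm) sum_nonneg_eq_0_iff) (auto simp: cinner_ge_zero)
    then have "x i = 0" if "i < r" for i
      using that cinner_self[of "x i"] cinner_eq_zero_imp[of "x i"] by simp
    then show ?thesis by (simp add: u)
  qed
qed

end

end

section \<open>The space of square-summable sequences\<close>

typedef ell2 = "{x :: nat \<Rightarrow> complex. summable (\<lambda>n. (cmod (x n))\<^sup>2)}"
  by (rule exI[of _ "\<lambda>_. 0"]) simp

setup_lifting type_definition_ell2

lemma summable_ell2_prod:
  assumes "summable (\<lambda>n. (cmod (x n))\<^sup>2)" "summable (\<lambda>n. (cmod (y n))\<^sup>2)"
  shows "summable (\<lambda>n. x n * cnj (y n))"
proof (rule summable_comparison_test')
  show "summable (\<lambda>n. (cmod (x n))\<^sup>2 + (cmod (y n))\<^sup>2)" by (intro summable_add assms)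
  show "norm (x n * cnj (y n)) \<le> (cmod (x n))\<^sup>2 + (cmod (y n))\<^sup>2" for n
  proof -
    have "2 * (cmod (x n) * cmod (y n)) \<le> (cmod (x n))\<^sup>2 + (cmod (y n))\<^sup>2"
      using sum_squares_bound[of "cmod (x n)" "cmod (y n)"] by simp
    moreover have "0 \<le> cmod (x n) * cmod (y n)" by simp
    ultimately show ?thesis by (simp only: norm_mult complex_mod_cnj)
  qed
qed

lemma summable_ell2_add:
  assumes "summable (\<lambda>n. (cmod (x n))\<^sup>2)" "summable (\<lambda>n. (cmod (y n))\<^sup>2)"
  shows "summable (\<lambda>n. (cmod (x n + y n))\<^sup>2)"
proof (rule summable_comparison_test')
  show "summable (\<lambda>n. 2 * (cmod (x n))\<^sup>2 + 2 * (cmod (y n))\<^sup>2)"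
    by (intro summable_add summable_mult assms)
  show "norm ((cmod (x n + y n))\<^sup>2) \<le> 2 * (cmod (x n))\<^sup>2 + 2 * (cmod (y n))\<^sup>2" for n
  proof -
    have "(cmod (x n + y n))\<^sup>2 \<le> (cmod (x n) + cmod (y n))\<^sup>2"
      by (intro power_mono norm_triangle_ineq) simp
    also have "\<dots> \<le> 2 * (cmod (x n))\<^sup>2 + 2 * (cmod (y n))\<^sup>2"
      using sum_squares_bound[of "cmod (x n)" "cmod (y n)"] by (simp add: power2_sum)
    finally show ?thesis by simp
  qed
qed

lemma summable_ell2_scale:
  "summable (\<lambda>n. (cmod (x n))\<^sup>2) \<Longrightarrow> summable (\<lambda>n. (cmod (c * x n))\<^sup>2)"
  by (simp add: norm_mult power_mult_distrib summable_mult)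

instantiation ell2 :: complex_inner
begin

lift_definition zero_ell2 :: ell2 is "\<lambda>_. 0" by simp

lift_definition plus_ell2 :: "ell2 \<Rightarrow> ell2 \<Rightarrow> ell2" is "\<lambda>x y n. x n + y n"
  by (rule summable_ell2_add)

lift_definition uminus_ell2 :: "ell2 \<Rightarrow> ell2" is "\<lambda>x n. - x n" by simp

lift_definition minus_ell2 :: "ell2 \<Rightarrow> ell2 \<Rightarrow> ell2" is "\<lambda>x y n. x n - y n"
proof -
  fix x y :: "nat \<Rightarrow> complex"
  assume "summable (\<lambda>n. (cmod (x n))\<^sup>2)" "summable (\<lambda>n. (cmod (y n))\<^sup>2)"
  then show "summable (\<lambda>n. (cmod (x n - y n))\<^sup>2)"
    using summable_ell2_add[of x "\<lambda>n. - y n"] by simp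
qed

lift_definition scaleC_ell2 :: "complex \<Rightarrow> ell2 \<Rightarrow> ell2" is "\<lambda>c x n. c * x n"
  by (rule summable_ell2_scale)

lift_definition cinner_ell2 :: "ell2 \<Rightarrow> ell2 \<Rightarrow> complex" is "\<lambda>x y. suminf (\<lambda>n. x n * cnj (y n))" .

instance
proof
  fix x y z :: ell2 and c d :: complex
  show "x + y + z = x + (y + z)" by transfer (simp add: algebra_simps)
  show "x + y = y + x" by transfer (simp add: algebra_simps)
  show "0 + x = x" by transfer simp
  show "- x + x = 0" by transfer simp
  show "x - y = x + - y" by transfer simp
  show "c *\<^sub>C (x + y) = c *\<^sub>C x + c *\<^sub>C y" by transfer (simp add: algebra_simps)
  show "(c + d) *\<^sub>C x = c *\<^sub>C x + d *\<^sub>C x" by transfer (simp add: algebra_simps)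
  show "c *\<^sub>C d *\<^sub>C x = (c * d) *\<^sub>C x" by transfer (simp add: algebra_simps)
  show "1 *\<^sub>C x = x" by transfer simp
  show "cinner x y = cnj (cinner y x)"
  proof transfer
    fix x y :: "nat \<Rightarrow> complex"
    assume "summable (\<lambda>n. (cmod (x n))\<^sup>2)" "summable (\<lambda>n. (cmod (y n))\<^sup>2)"
    then have "(\<lambda>n. y n * cnj (x n)) sums suminf (\<lambda>n. y n * cnj (x n))"
      by (intro summable_sums summable_ell2_prod)
    then have "(\<lambda>n. cnj (y n * cnj (x n))) sums cnj (suminf (\<lambda>n. y n * cnj (x n)))"
      by (simp only: sums_cnj)
    then show "suminf (\<lambda>n. x n * cnj (y n)) = cnj (suminf (\<lambda>n. y n * cnj (x n)))"
      by (simp add: sums_iff mult.commute)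
  qed
  show "cinner (x + y) z = cinner x z + cinner y z"
    by transfer (simp add: suminf_add summable_ell2_prod distrib_right)
  show "cinner (c *\<^sub>C x) y = c * cinner x y"
    by transfer (simp add: suminf_mult[symmetric] summable_ell2_prod mult.assoc)
  have sq: "suminf (\<lambda>n. x n * cnj (x n)) = of_real (suminf (\<lambda>n. (cmod (x n))\<^sup>2))"
    if "summable (\<lambda>n. (cmod (x n))\<^sup>2)" for x :: "nat \<Rightarrow> complex"
    using suminf_of_real[OF that, where 'a = complex] by (simp only: complex_norm_square)
  show "0 \<le> Re (cinner x x)"
    by transfer (simp add: sq suminf_nonneg)
  show "x = 0" if "cinner x x = 0"
    using that
    by transfer (auto simp only: sq of_real_eq_0_iff suminf_eq_zero_iff zero_le_power2
        power_eq_0_iff norm_eq_zero)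
qed

end

text \<open>\<open>ell2_unit m\<close> has the entry 1 at index \<open>m\<close> (indices start at 0) and 0 elsewhere.\<close>

lift_definition ell2_unit :: "nat \<Rightarrow> ell2" is "\<lambda>m n. if n = m then 1 else 0"
proof -
  fix m :: nat
  have "(\<lambda>n. (cmod (if n = m then 1 else 0))\<^sup>2) = (\<lambda>n. if n = m then 1 else 0)" by auto
  then show "summable (\<lambda>n. (cmod (if n = m then 1 else 0))\<^sup>2)" by simp
qed

section \<open>\<open>PL\<close>-spaces and their tensor product\<close>

definition op_action ::
    "('h::chilbert_space \<Rightarrow> 'h) \<Rightarrow> ('h, 'e::complex_vector) tensor \<Rightarrow> ('h, 'e) tensor"
  where "op_action a = tensor_lift (\<lambda>\<xi> x. a \<xi> \<otimes> x)"

text \<open>\<open>pl_space N\<close>: the norm \<open>N\<close> on \<open>HE\<close> makes \<open>E\<close> a \<open>PL\<close>-space.\<close>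

definition pl_space :: "(('h::chilbert_space, 'e::complex_vector) tensor \<Rightarrow> real) \<Rightarrow> bool"
  where "pl_space N \<longleftrightarrow>
    (\<forall>u. 0 \<le> N u) \<and> (\<forall>u. N u = 0 \<longleftrightarrow> u = 0) \<and>
    (\<forall>u v. N (u + v) \<le> N u + N v) \<and> (\<forall>c u. N (c *\<^sub>C u) = cmod c * N u) \<and>
    (\<forall>a u. bounded_clinear a \<longrightarrow> N (op_action a u) \<le> onorm a * N u)"

text \<open>\<open>diamond d u v\<close> is \<open>u \<diamondsuit> v\<close>, where \<open>d \<xi> \<eta> = \<xi> \<diamondsuit> \<eta>\<close> is the given product on \<open>H\<close>.\<close>

definition diamond ::
    "('h \<Rightarrow> 'h \<Rightarrow> 'h) \<Rightarrow> ('h::chilbert_space, 'e::complex_vector) tensor \<Rightarrow>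
      ('h, 'f::complex_vector) tensor \<Rightarrow> ('h, ('e, 'f) tensor) tensor"
  where "diamond d u v =
    tensor_lift (\<lambda>\<xi> x. tensor_lift (\<lambda>\<eta> y. d \<xi> \<eta> \<otimes> (x \<otimes> y)) v) u"

definition pl_tensor_norm ::
    "('h \<Rightarrow> 'h \<Rightarrow> 'h) \<Rightarrow> (('h::chilbert_space, 'e::complex_vector) tensor \<Rightarrow> real) \<Rightarrow>
      (('h, 'f::complex_vector) tensor \<Rightarrow> real) \<Rightarrow> ('h, ('e, 'f) tensor) tensor \<Rightarrow> real"
  where "pl_tensor_norm d N\<^sub>E N\<^sub>F U =
    Inf {(\<Sum>k<m. onorm (a k) * N\<^sub>E (u k) * N\<^sub>F (v k)) | (m::nat) a u v.
      (\<forall>k<m. bounded_clinear (a k)) \<and> U = (\<Sum>k<m. op_action (a k) (diamond d (u k) (v k)))}"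

lemma op_action_pure: "clinear a \<Longrightarrow> op_action a (\<xi> \<otimes> x) = a \<xi> \<otimes> x"
  unfolding op_action_def
  by (rule tensor_lift_pure, rule cbilinearI)
    (simp_all add: clinear_add clinear_scaleC tensor_add_left tensor_add_right
      tensor_scaleC_left tensor_scaleC_right)

lemma diamond:
  fixes d :: "'h \<Rightarrow> 'h \<Rightarrow> 'h::chilbert_space" and x :: "'e::complex_vector" and y :: "'f::complex_vector"
  assumes "cbilinear d"
  shows diamond_pure: "diamond d (\<xi> \<otimes> x) (\<eta> \<otimes> y) = d \<xi> \<eta> \<otimes> (x \<otimes> y)"
    and cbilinear_diamond: "cbilinear (diamond d :: ('h, 'e) tensor \<Rightarrow> ('h, 'f) tensor \<Rightarrow> _)"
proof -
  have lin: "clinear (d \<xi>)" "clinear (\<lambda>\<xi>. d \<xi> \<eta>)" for \<xi> \<eta>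
    using assms by (auto simp: cbilinear_def)
  note simps = clinear_add[OF lin(1)] clinear_add[OF lin(2)] clinear_scaleC[OF lin(1)]
    clinear_scaleC[OF lin(2)] tensor_add_left tensor_add_right tensor_scaleC_left
    tensor_scaleC_right
  have b1: "cbilinear (\<lambda>\<eta> (y::'f). d \<xi> \<eta> \<otimes> ((x::'e) \<otimes> y))"
    for \<xi> x by (rule cbilinearI) (simp_all add: simps)
  have b2: "cbilinear (\<lambda>\<xi> (x::'e).
      tensor_lift (\<lambda>\<eta> (y::'f). d \<xi> \<eta> \<otimes> (x \<otimes> y)) v)" for v
    by (rule cbilinearI; induction v rule: tensor_induct,
      simp_all only: clinear_zero[OF clinear_tensor_lift[OF b1]]
        clinear_add[OF clinear_tensor_lift[OF b1]] tensor_lift_pure[OF b1])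
      (simp_all add: simps algebra_simps)
  show "diamond d (\<xi> \<otimes> x) (\<eta> \<otimes> y) = d \<xi> \<eta> \<otimes> (x \<otimes> y)"
    unfolding diamond_def tensor_lift_pure[OF b2] by (rule tensor_lift_pure[OF b1])
  have left: "clinear (\<lambda>u :: ('h, 'e) tensor. diamond d u v)" for v :: "('h, 'f) tensor"
    unfolding diamond_def by (rule clinear_tensor_lift[OF b2])
  have pure: "diamond d (\<xi> \<otimes> x) v = tensor_lift (\<lambda>\<eta> y. d \<xi> \<eta> \<otimes> (x \<otimes> y)) v"
    for \<xi> and x :: 'e and v :: "('h, 'f) tensor"
    unfolding diamond_def by (rule tensor_lift_pure[OF b2])
  have "clinear (diamond d u :: ('h, 'f) tensor \<Rightarrow> _)" for u :: "('h, 'e) tensor"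
    by (rule clinearI; induction u rule: tensor_induct)
      (simp_all add: clinear_zero[OF left] clinear_add[OF left] pure
        clinear_add[OF clinear_tensor_lift[OF b1]] clinear_scaleC[OF clinear_tensor_lift[OF b1]]
        algebra_simps)
  with left show "cbilinear (diamond d :: ('h, 'e) tensor \<Rightarrow> ('h, 'f) tensor \<Rightarrow> _)"
    by (simp add: cbilinear_def)
qed

lemma cinner_norm_nonneg: "0 \<le> cinner_norm x"
  by (simp add: cinner_norm_def cinner_ge_zero)

lemma cinner_norm_square: "(cinner_norm x)\<^sup>2 = Re (cinner x x)"
  by (simp add: cinner_norm_def cinner_ge_zero)

lemma cinner_norm_eq_0_iff: "cinner_norm x = 0 \<longleftrightarrow> x = 0"
  using cinner_self[of x] cinner_eq_zero_imp[of x] by (auto simp: cinner_norm_def)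

lemma cinner_norm_scaleC: "cinner_norm (c *\<^sub>C x) = cmod c * cinner_norm x"
proof -
  have "cinner (c *\<^sub>C x) (c *\<^sub>C x) = of_real ((cmod c)\<^sup>2) * cinner x x"
    by (simp only: cinner_scaleC_left cinner_scaleC_right complex_norm_square mult_ac)
  then have "Re (cinner (c *\<^sub>C x) (c *\<^sub>C x)) = (cmod c)\<^sup>2 * Re (cinner x x)"
    by simp
  then show ?thesis by (simp add: cinner_norm_def real_sqrt_mult)
qed

lemma Re_cinner_le: "Re (cinner x y) \<le> cinner_norm x * cinner_norm (y::'a::complex_inner)"
proof (cases "x = 0 \<or> y = 0")
  case False
  define p q where "p = cinner_norm x" and "q = cinner_norm y"
  have pos: "p > 0" "q > 0"
    using False by (auto simp: p_def q_def less_le cinner_norm_nonneg cinner_norm_eq_0_iff)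
  have sym: "Re (cinner y x) = Re (cinner x y)" by (subst cinner_commute) simp
  have "Re (cinner (of_real s *\<^sub>C x + of_real t *\<^sub>C y) (of_real s *\<^sub>C x + of_real t *\<^sub>C y)) =
      s\<^sup>2 * Re (cinner x x) + t\<^sup>2 * Re (cinner y y) + 2 * (s * t) * Re (cinner x y)" for s t
    by (simp add: cinner_add_left cinner_add_right cinner_scaleC_left cinner_scaleC_right
        sym power2_eq_square algebra_simps)
  note expand = this[of q "- p"]
  have squares: "Re (cinner x x) = p\<^sup>2" "Re (cinner y y) = q\<^sup>2"
    by (simp_all add: p_def q_def cinner_norm_square)
  have "0 \<le> q\<^sup>2 * p\<^sup>2 + (- p)\<^sup>2 * q\<^sup>2 + 2 * (q * - p) * Re (cinner x y)"
    using cinner_ge_zero[of "of_real q *\<^sub>C x + of_real (- p) *\<^sub>C y"]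
    unfolding expand squares .
  then have "(p * q) * Re (cinner x y) \<le> (p * q) * (p * q)"
    by (simp add: power2_eq_square algebra_simps)
  then show ?thesis using pos by (simp add: p_def q_def)
qed (auto simp: cinner_norm_nonneg)

lemma cinner_norm_triangle:
  "cinner_norm (x + y) \<le> cinner_norm x + cinner_norm (y::'a::complex_inner)"
proof (rule power2_le_imp_le)
  have "Re (cinner y x) = Re (cinner x y)" by (subst cinner_commute) simp
  then show "(cinner_norm (x + y))\<^sup>2 \<le> (cinner_norm x + cinner_norm y)\<^sup>2"
    using Re_cinner_le[of x y]
    by (simp add: cinner_norm_square power2_sum cinner_add_left cinner_add_right)
qed (simp add: cinner_norm_nonneg)

lemma clinear_op_action: "clinear a \<Longrightarrow> clinear (op_action a)"
  unfolding op_action_def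
  by (rule clinear_tensor_lift, rule cbilinearI)
    (simp_all add: clinear_add clinear_scaleC tensor_add_left tensor_add_right
      tensor_scaleC_left tensor_scaleC_right)

lemma pl_space_cinner_norm:
  "pl_space (cinner_norm :: ('h::chilbert_space, 'e::complex_inner) tensor \<Rightarrow> real)"
proof -
  have "cinner_norm (op_action a u) \<le> onorm a * cinner_norm u"
    if a: "bounded_clinear a" for a and u :: "('h, 'e) tensor"
  proof (rule power2_le_imp_le)
    have lin: "clinear a" and bdd: "bounded_linear a" using a by (auto simp: bounded_clinear_def)
    define F where "F = (tensor_lift (\<lambda>x y. y \<otimes> x) :: ('h, 'e) tensor \<Rightarrow> _)"
    define G where "G = (tensor_lift (\<lambda>x y. y \<otimes> x) :: ('e, 'h) tensor \<Rightarrow> _)"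
    have F: "clinear F" "F (x \<otimes> y) = y \<otimes> x" and G: "clinear G" "G (y \<otimes> x) = x \<otimes> y" for x y
      by (simp_all add: F_def G_def clinear_tensor_lift cbilinear_pure_tensor_flip tensor_lift_pure)
    have GF: "G (F u) = u"
      by (induction u rule: tensor_induct)
        (simp_all add: clinear_zero clinear_add F G)
    obtain r :: nat and f :: "nat \<Rightarrow> 'e" and x :: "nat \<Rightarrow> 'h"
      where on: "\<And>i k. i < r \<Longrightarrow> k < r \<Longrightarrow> cinner (f i) (f k) = (if i = k then 1 else 0)"
        and Fu: "F u = (\<Sum>i<r. f i \<otimes> x i)"
      using orthonormal_representation[of "F u"] by blast
    have u: "u = (\<Sum>i<r. x i \<otimes> f i)"
      using arg_cong[OF Fu, of G] by (simp add: GF clinear_sum G)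
    have norm: "(cinner_norm (\<Sum>i<r. z i \<otimes> f i))\<^sup>2 = (\<Sum>i<r. (norm (z i))\<^sup>2)"
      for z :: "nat \<Rightarrow> 'h"
    proof -
      have "cinner (\<Sum>i<r. z i \<otimes> f i) (\<Sum>i<r. z i \<otimes> f i) =
          (\<Sum>k<r. \<Sum>i<r. cinner (z i) (z k) * cinner (f i) (f k))"
        by (simp add: cinner_sum_left cinner_sum_right cinner_pure_tensor)
      also have "\<dots> = (\<Sum>k<r. \<Sum>i<r. if i = k then cinner (z i) (z k) else 0)"
        by (intro sum.cong refl) (auto simp: on)
      also have "\<dots> = (\<Sum>k<r. cinner (z k) (z k))" by (intro sum.cong refl) simp
      finally show ?thesis
        by (simp add: cinner_norm_square norm_eq_sqrt_cinner cinner_ge_zero)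
    qed
    have "(cinner_norm (op_action a u))\<^sup>2 = (\<Sum>i<r. (norm (a (x i)))\<^sup>2)"
      by (simp add: u clinear_sum clinear_op_action lin op_action_pure norm)
    also have "\<dots> \<le> (\<Sum>i<r. (onorm a)\<^sup>2 * (norm (x i))\<^sup>2)"
      using onorm[OF bdd] by (intro sum_mono) (metis norm_ge_zero power_mono power_mult_distrib)
    also have "\<dots> = (onorm a * cinner_norm u)\<^sup>2"
      by (simp add: power_mult_distrib norm[of x, folded u] sum_distrib_left)
    finally show "(cinner_norm (op_action a u))\<^sup>2 \<le> (onorm a * cinner_norm u)\<^sup>2" .
    show "0 \<le> onorm a * cinner_norm u" by (simp add: onorm_pos_le bdd cinner_norm_nonneg)
  qed
  then show ?thesis
    by (simp add: pl_space_def cinner_norm_nonneg cinner_norm_eq_0_iff cinner_norm_triangle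
        cinner_norm_scaleC)
qed

end

(* The lower bound comes from the functional U \<mapsto> \<Sum>k<n. \<langle>(1 \<otimes> \<langle>\<cdot>, p k \<otimes> p k\<rangle>) U, e k\<rangle>, which takes the
   value n at V.  On a\<cdot>(u \<diamondsuit> v) it equals \<Sum>k<n. \<langle>a (u k \<diamondsuit> v k), e k\<rangle>, where u k and v k are the k-th
   coordinates of u and v in H, so by Cauchy-Schwarz and Bessel it is bounded by \<parallel>a\<parallel> \<parallel>u\<parallel> \<parallel>v\<parallel>.
   The bound is attained at u = v = \<Sum>k<n. e k \<otimes> p k, whose norm is \<surd>n, with a the partial isometry
   that maps e k \<diamondsuit> e k to e k and vanishes on the orthogonal complement of these vectors. *)

theory Submission
  imports Defs
begin

section \<open>Orthonormal families in inner product spaces\<close>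

lemma norm_eq_cinner_norm: "norm (x::'h::chilbert_space) = cinner_norm x"
  by (simp add: norm_eq_sqrt_cinner cinner_norm_def)

text \<open>Rotating \<open>x\<close> by the unimodular factor \<open>c\<close> makes the inner
  product real and nonnegative without changing the norm of \<open>x\<close>, so the bound on the
  real part suffices.\<close>

lemma cmod_cinner_le: "cmod (cinner x y) \<le> cinner_norm x * cinner_norm (y::'a::complex_inner)"
proof (cases "cinner x y = 0")
  case False
  define c where "c = cnj (sgn (cinner x y))"
  have c: "cmod c = 1"
    using False by (simp add: c_def norm_sgn)
  have "c * cinner x y = of_real (cmod (cinner x y))"
    using False by (simp add: c_def sgn_eq complex_norm_square[symmetric] power2_eq_square
        mult.commute[of "cnj _"])
  then have "cmod (cinner x y) = Re (cinner (c *\<^sub>C x) y)"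
    by (simp add: cinner_scaleC_left)
  also have "\<dots> \<le> cinner_norm (c *\<^sub>C x) * cinner_norm y"
    by (rule Re_cinner_le)
  finally show ?thesis
    by (simp add: cinner_norm_scaleC c)
qed (simp add: cinner_norm_nonneg)

lemma cinner_norm_sum_orthogonal:
  assumes "\<And>i k. i \<in> A \<Longrightarrow> k \<in> A \<Longrightarrow> i \<noteq> k \<Longrightarrow> cinner (g i) (g k) = 0"
  shows "(cinner_norm (\<Sum>i\<in>A. g i))\<^sup>2 = (\<Sum>i\<in>A. (cinner_norm (g i :: 'a::complex_inner))\<^sup>2)"
proof (cases "finite A")
  case True
  have "cinner (\<Sum>i\<in>A. g i) (\<Sum>i\<in>A. g i) = (\<Sum>k\<in>A. \<Sum>i\<in>A. cinner (g i) (g k))"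
    by (simp add: cinner_sum_left cinner_sum_right)
  also have "\<dots> = (\<Sum>k\<in>A. \<Sum>i\<in>A. if i = k then cinner (g k) (g k) else 0)"
    by (intro sum.cong refl) (auto simp: assms)
  also have "\<dots> = (\<Sum>k\<in>A. cinner (g k) (g k))"
    using True by (intro sum.cong refl) simp
  finally show ?thesis
    by (simp add: cinner_norm_square)
\<comment> \<open>For infinite \<open>A\<close> both sums are 0 by convention, so finiteness need
  not be assumed.\<close>
qed (simp add: cinner_norm_def)

lemma cinner_norm_sum_orthonormal:
  assumes "\<And>i k. i \<in> A \<Longrightarrow> k \<in> A \<Longrightarrow> cinner (f i) (f k) = (if i = k then 1 else 0)"
  shows "(cinner_norm (\<Sum>i\<in>A. c i *\<^sub>C (f i :: 'a::complex_inner)))\<^sup>2 = (\<Sum>i\<in>A. (cmod (c i))\<^sup>2)"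
proof -
  have "cinner_norm (c i *\<^sub>C f i) = cmod (c i)" if "i \<in> A" for i
    using assms[OF that that] by (simp add: cinner_norm_scaleC) (simp add: cinner_norm_def)
  then show ?thesis
    by (subst cinner_norm_sum_orthogonal)
      (auto simp: assms cinner_scaleC_left cinner_scaleC_right)
qed

text \<open>The orthogonal projection \<open>y\<close> of \<open>x\<close> onto the span of the
  family has inner product with \<open>x\<close> equal to its own squared norm; Cauchy-Schwarz then
  gives that \<open>y\<close> is no longer than \<open>x\<close>.\<close>

lemma Bessel_inequality:
  assumes "\<And>i k. i \<in> A \<Longrightarrow> k \<in> A \<Longrightarrow> cinner (f i) (f k) = (if i = k then 1 else 0)"
  shows "(\<Sum>i\<in>A. (cmod (cinner x (f i)))\<^sup>2) \<le> (cinner_norm (x::'a::complex_inner))\<^sup>2"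
proof -
  define y where "y = (\<Sum>i\<in>A. cinner x (f i) *\<^sub>C f i)"
  have y: "(cinner_norm y)\<^sup>2 = (\<Sum>i\<in>A. (cmod (cinner x (f i)))\<^sup>2)"
    unfolding y_def by (rule cinner_norm_sum_orthonormal[OF assms])
  have "cinner x y = (\<Sum>i\<in>A. of_real ((cmod (cinner x (f i)))\<^sup>2))"
    by (simp only: y_def cinner_sum_right cinner_scaleC_right complex_norm_square mult.commute)
  then have "(cinner_norm y)\<^sup>2 \<le> cinner_norm x * cinner_norm y"
    using Re_cinner_le[of x y] by (simp add: y)
  then have "cinner_norm y \<le> cinner_norm x"
    using cinner_norm_nonneg[of x] cinner_norm_nonneg[of y]
    by (cases "cinner_norm y = 0") (auto simp: power2_eq_square)
  then show ?thesis
    unfolding y[symmetric] by (intro power_mono cinner_norm_nonneg)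
qed

lemma cinner_norm_pure_tensor: "cinner_norm (x \<otimes> y) = cinner_norm x * cinner_norm y"
proof -
  \<comment> \<open>The real part of a product splits into the product of the real parts only
    because this factor is real.\<close>
  have "Im (cinner x x) = 0"
    by (metis cinner_self Im_complex_of_real)
  then show ?thesis
    by (simp add: cinner_norm_def cinner_pure_tensor real_sqrt_mult)
qed

lemma cinner_norm_sum_tensor_orthonormal:
  fixes f :: "'i \<Rightarrow> 'a::complex_inner" and x :: "'i \<Rightarrow> 'b::complex_inner"
  assumes "\<And>i k. i \<in> A \<Longrightarrow> k \<in> A \<Longrightarrow> cinner (f i) (f k) = (if i = k then 1 else 0)"
  shows "(cinner_norm (\<Sum>i\<in>A. f i \<otimes> x i))\<^sup>2 = (\<Sum>i\<in>A. (cinner_norm (x i))\<^sup>2)"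
proof -
  have "cinner_norm (f i) = 1" if "i \<in> A" for i
    using assms[OF that that] by (simp add: cinner_norm_def)
  then show ?thesis
    by (subst cinner_norm_sum_orthogonal)
      (auto simp: assms cinner_pure_tensor cinner_norm_pure_tensor)
qed

lemma cinner_ell2_unit: "cinner (ell2_unit i) (ell2_unit k) = (if i = k then 1 else 0)"
proof transfer
  fix i k :: nat
  have "(\<lambda>n. (if n = i then 1 else 0) * cnj (if n = k then 1 else 0))
      = (\<lambda>n. if n = i then if i = k then 1 else 0 else (0::complex))"
    by auto
  then show "suminf (\<lambda>n. (if n = i then 1 else 0) * cnj (if n = k then 1 else 0))
      = (if i = k then 1 else (0::complex))"
    using sums_unique[OF sums_single[of i "\<lambda>_. if i = k then 1 else (0::complex)"]] by simp
qed

section \<open>Slices\<close>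

text \<open>The map 1 \<otimes> \<langle>\<cdot>, q\<rangle> from HE to H. With \<open>q\<close> a
  member of an orthonormal family it extracts an H-valued coordinate.\<close>

definition slice ::
    "'e::complex_inner \<Rightarrow> ('h::complex_vector, 'e) tensor \<Rightarrow> 'h"
  where "slice q = tensor_lift (\<lambda>\<xi> x. cinner x q *\<^sub>C \<xi>)"

lemma slice_cbilinear: "cbilinear (\<lambda>\<xi> x. cinner x q *\<^sub>C \<xi>)"
  by (rule cbilinearI)
    (simp_all add: cinner_add_left cinner_scaleC_left scaleC_add_left scaleC_add_right
      scaleC_scaleC mult.commute)

lemma clinear_slice: "clinear (slice q)"
  unfolding slice_def by (rule clinear_tensor_lift[OF slice_cbilinear])

lemma slice_pure: "slice q (\<xi> \<otimes> x) = cinner x q *\<^sub>C \<xi>"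
  unfolding slice_def by (rule tensor_lift_pure[OF slice_cbilinear])

text \<open>The operator works on the H factor and the slice on the other one, so the two
  commute.\<close>

lemma slice_op_action:
  assumes "clinear a"
  shows "slice q (op_action a u) = a (slice q u)"
  by (induction u rule: tensor_induct)
    (simp_all add: clinear_zero[OF clinear_op_action[OF assms]] clinear_zero[OF clinear_slice]
      clinear_zero[OF assms] clinear_add[OF clinear_op_action[OF assms]]
      clinear_add[OF clinear_slice] clinear_add[OF assms] op_action_pure[OF assms]
      slice_pure clinear_scaleC[OF assms])

lemma slice_diamond:
  fixes d :: "'h \<Rightarrow> 'h \<Rightarrow> 'h::chilbert_space"
    and u :: "('h, 'e::complex_inner) tensor" and v :: "('h, 'f::complex_inner) tensor"
  assumes "cbilinear d"
  shows "slice (p \<otimes> q) (diamond d u v) = d (slice p u) (slice q v)"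
proof -
  have lin: "clinear (d \<xi>)" "clinear (\<lambda>\<xi>. d \<xi> \<eta>)" for \<xi> \<eta>
    using assms by (auto simp: cbilinear_def)
  have dia: "clinear (diamond d u)" "clinear (\<lambda>u. diamond d u v)"
    for u :: "('h, 'e) tensor" and v :: "('h, 'f) tensor"
    using cbilinear_diamond[OF assms] by (auto simp: cbilinear_def)
  note simps = clinear_zero[OF lin(1)] clinear_zero[OF lin(2)] clinear_add[OF lin(1)]
    clinear_add[OF lin(2)] clinear_scaleC[OF lin(1)] clinear_scaleC[OF lin(2)]
    clinear_zero[OF dia(1)] clinear_zero[OF dia(2)] clinear_add[OF dia(1)] clinear_add[OF dia(2)]
    clinear_zero[OF clinear_slice] clinear_add[OF clinear_slice] slice_pure
  \<comment> \<open>Induction on \<open>v\<close> with a pure left argument; induction on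
    \<open>u\<close> then only needs linearity.\<close>
  have pure: "slice (p \<otimes> q) (diamond d (\<xi> \<otimes> x) v) = d (slice p (\<xi> \<otimes> x)) (slice q v)"
    for \<xi> and x :: 'e
    by (induction v rule: tensor_induct)
      (simp_all add: simps diamond_pure[OF assms] cinner_pure_tensor scaleC_scaleC
        scaleC_add_right mult.commute)
  show ?thesis
    by (induction u rule: tensor_induct) (simp_all only: simps pure)
qed

text \<open>Expanding \<open>u\<close> along an orthonormal system of H turns each slice norm into a
  sum of squared scalar coefficients. After swapping the sums, Bessel applies to each coefficient
  vector \<open>x i\<close>.\<close>

lemma sum_slice_le:
  fixes u :: "('h::complex_inner, 'e::complex_inner) tensor"
  assumes "\<And>i k. i \<in> A \<Longrightarrow> k \<in> A \<Longrightarrow> cinner (p i) (p k) = (if i = k then 1 else 0)"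
  shows "(\<Sum>k\<in>A. (cinner_norm (slice (p k) u))\<^sup>2) \<le> (cinner_norm u)\<^sup>2"
proof -
  obtain r :: nat and f :: "nat \<Rightarrow> 'h" and x :: "nat \<Rightarrow> 'e"
    where on: "\<And>i k. i < r \<Longrightarrow> k < r \<Longrightarrow> cinner (f i) (f k) = (if i = k then 1 else 0)"
      and u: "u = (\<Sum>i<r. f i \<otimes> x i)"
    using orthonormal_representation[of u] by blast
  have "(cinner_norm (slice q u))\<^sup>2 = (\<Sum>i<r. (cmod (cinner (x i) q))\<^sup>2)" for q
    unfolding u clinear_sum[OF clinear_slice] slice_pure
    by (rule cinner_norm_sum_orthonormal) (simp add: on)
  then have "(\<Sum>k\<in>A. (cinner_norm (slice (p k) u))\<^sup>2)
      = (\<Sum>i<r. \<Sum>k\<in>A. (cmod (cinner (x i) (p k)))\<^sup>2)"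
    by (simp add: sum.swap[of _ _ A])
  also have "\<dots> \<le> (\<Sum>i<r. (cinner_norm (x i))\<^sup>2)"
    by (intro sum_mono Bessel_inequality assms)
  also have "\<dots> = (cinner_norm u)\<^sup>2"
    unfolding u by (rule cinner_norm_sum_tensor_orthonormal[symmetric]) (simp add: on)
  finally show ?thesis .
qed

section \<open>The norm of the diagonal tensor\<close>

text \<open>Cauchy-Schwarz enters twice: in H, to pair each slice with the unit vector
  \<open>e k\<close>, and then for the sum over \<open>k\<close>. The two resulting l2 sums are
  those of \<open>sum_slice_le\<close>.\<close>

lemma diagonal_functional_le:
  fixes d :: "'h \<Rightarrow> 'h \<Rightarrow> 'h::chilbert_space"
    and u :: "('h, 'e::complex_inner) tensor" and v :: "('h, 'f::complex_inner) tensor"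
  assumes d: "cbilinear d" and norm_d: "\<And>\<xi> \<eta>. norm (d \<xi> \<eta>) = norm \<xi> * norm \<eta>"
    and a: "bounded_clinear a"
    and e: "\<And>k. k \<in> A \<Longrightarrow> norm (e k) = 1"
    and p: "\<And>i k. i \<in> A \<Longrightarrow> k \<in> A \<Longrightarrow> cinner (p i) (p k) = (if i = k then 1 else 0)"
    and q: "\<And>i k. i \<in> A \<Longrightarrow> k \<in> A \<Longrightarrow> cinner (q i) (q k) = (if i = k then 1 else 0)"
  shows "cmod (\<Sum>k\<in>A. cinner (slice (p k \<otimes> q k) (op_action a (diamond d u v))) (e k))
    \<le> onorm a * cinner_norm u * cinner_norm v"
proof -
  have lin: "clinear a" and bdd: "bounded_linear a"
    using a by (auto simp: bounded_clinear_def)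
  let ?s = "\<lambda>k. norm (slice (p k) u)" and ?t = "\<lambda>k. norm (slice (q k) v)"
  have "cmod (cinner (slice (p k \<otimes> q k) (op_action a (diamond d u v))) (e k))
      \<le> onorm a * (?s k * ?t k)" if "k \<in> A" for k
    using cmod_cinner_le[of "a (d (slice (p k) u) (slice (q k) v))" "e k"] e[OF that]
      onorm[OF bdd, of "d (slice (p k) u) (slice (q k) v)"]
    by (simp add: slice_op_action[OF lin] slice_diamond[OF d] norm_d norm_eq_cinner_norm[symmetric])
  then have "cmod (\<Sum>k\<in>A. cinner (slice (p k \<otimes> q k) (op_action a (diamond d u v))) (e k))
      \<le> onorm a * (\<Sum>k\<in>A. ?s k * ?t k)"
    by (simp add: sum_distrib_left sum_norm_le)
  also have "(\<Sum>k\<in>A. ?s k * ?t k) \<le> L2_set ?s A * L2_set ?t A"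
    using L2_set_mult_ineq[of ?s ?t A] by simp
  also have "\<dots> \<le> cinner_norm u * cinner_norm v"
    using real_sqrt_le_mono[OF sum_slice_le[OF p, of A u]]
      real_sqrt_le_mono[OF sum_slice_le[OF q, of A v]]
    by (intro mult_mono) (simp_all add: L2_set_def norm_eq_cinner_norm cinner_norm_nonneg sum_nonneg)
  finally show ?thesis
    by (simp add: mult.assoc mult_left_mono onorm_pos_le[OF bdd])
qed

text \<open>Contractivity is Parseval for \<open>e\<close> followed by Bessel for \<open>f\<close>.
  The operator norm is only bounded by 1 because it is 0 when \<open>A\<close> is empty.\<close>

lemma partial_isometry:
  fixes e f :: "'i \<Rightarrow> 'h::chilbert_space"
  assumes e: "\<And>i k. i \<in> A \<Longrightarrow> k \<in> A \<Longrightarrow> cinner (e i) (e k) = (if i = k then 1 else 0)"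
    and f: "\<And>i k. i \<in> A \<Longrightarrow> k \<in> A \<Longrightarrow> cinner (f i) (f k) = (if i = k then 1 else 0)"
  defines "a \<equiv> \<lambda>\<xi>. \<Sum>k\<in>A. cinner \<xi> (f k) *\<^sub>C e k"
  shows bounded_clinear_partial_isometry: "bounded_clinear a"
    and onorm_partial_isometry_le: "onorm a \<le> 1"
proof -
  have "(norm (a \<xi>))\<^sup>2 \<le> (norm \<xi>)\<^sup>2" for \<xi>
    unfolding norm_eq_cinner_norm a_def
    by (subst cinner_norm_sum_orthonormal) (simp_all add: e Bessel_inequality[OF f])
  then have le: "norm (a \<xi>) \<le> 1 * norm \<xi>" for \<xi>
    using power2_le_imp_le by fastforce
  have lin: "clinear a"
    unfolding a_def
    by (rule clinearI)
      (simp_all add: cinner_add_left cinner_scaleC_left scaleC_add_left sum.distrib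
        complex_vector.scale_sum_right scaleC_scaleC)
  moreover have "bounded_linear a"
    by (rule bounded_linear_intro[of _ 1])
      (use le in \<open>simp_all add: clinear_add[OF lin] clinear_scaleC[OF lin] scaleR_scaleC\<close>)
  ultimately show "bounded_clinear a"
    by (simp add: bounded_clinear_def)
  show "onorm a \<le> 1"
    by (rule onorm_bound) (use le in simp_all)
qed

text \<open>All that matters about the diamond product is that it is bilinear and multiplies inner
  products, so the completion and the unitary do not appear here.\<close>

lemma pl_tensor_norm_diagonal:
  fixes d :: "'h \<Rightarrow> 'h \<Rightarrow> 'h::chilbert_space"
    and p :: "nat \<Rightarrow> 'e::complex_inner" and q :: "nat \<Rightarrow> 'f::complex_inner"
  assumes d: "cbilinear d"
    and cinner_d: "\<And>\<xi> \<eta> \<xi>' \<eta>'. cinner (d \<xi> \<eta>) (d \<xi>' \<eta>') = cinner \<xi> \<xi>' * cinner \<eta> \<eta>'"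
    and e: "\<And>i k. cinner (e i) (e k) = (if i = k then 1 else 0)"
    and p: "\<And>i k. cinner (p i) (p k) = (if i = k then 1 else 0)"
    and q: "\<And>i k. cinner (q i) (q k) = (if i = k then 1 else 0)"
  shows "pl_tensor_norm d cinner_norm cinner_norm (\<Sum>k<n. e k \<otimes> (p k \<otimes> q k)) = real n"
proof -
  define V where "V = (\<Sum>k<n. e k \<otimes> (p k \<otimes> q k))"
  \<comment> \<open>The set whose infimum defines the norm of \<open>V\<close>, named so that both
    bounds can be stated elementwise.\<close>
  define S where "S = {(\<Sum>k<m. onorm (a k) * cinner_norm (u k) * cinner_norm (v k)) | (m::nat) a u v.
      (\<forall>k<m. bounded_clinear (a k)) \<and> V = (\<Sum>k<m. op_action (a k) (diamond d (u k) (v k)))}"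
  have norm_d: "norm (d \<xi> \<eta>) = norm \<xi> * norm \<eta>" for \<xi> \<eta>
    using cinner_norm_pure_tensor[of \<xi> \<eta>]
    by (simp add: norm_eq_cinner_norm cinner_norm_def cinner_d cinner_pure_tensor)
  have norm_e: "norm (e k) = 1" for k
    by (simp add: norm_eq_sqrt_cinner e)

  define \<phi> where "\<phi> U = (\<Sum>k<n. cinner (slice (p k \<otimes> q k) U) (e k))" for U
  have "cinner (slice (p k \<otimes> q k) V) (e k) = 1" if "k < n" for k
  proof -
    have "cinner (slice (p k \<otimes> q k) V) (e k) = (\<Sum>i<n. if i = k then 1 else 0)"
      unfolding V_def clinear_sum[OF clinear_slice] slice_pure cinner_sum_left
      by (intro sum.cong refl) (simp add: cinner_scaleC_left cinner_pure_tensor e p q)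
    then show ?thesis
      using that by simp
  qed
  then have \<phi>_V: "\<phi> V = of_nat n"
    by (simp add: \<phi>_def)
  have lower: "real n \<le> s" if "s \<in> S" for s
  proof -
    obtain m :: nat and a u v where s: "s = (\<Sum>k<m. onorm (a k) * cinner_norm (u k) * cinner_norm (v k))"
      and a: "\<And>k. k < m \<Longrightarrow> bounded_clinear (a k)"
      and V: "V = (\<Sum>k<m. op_action (a k) (diamond d (u k) (v k)))"
      using \<open>s \<in> S\<close> by (auto simp: S_def)
    have sum: "\<phi> V = (\<Sum>k<m. \<phi> (op_action (a k) (diamond d (u k) (v k))))"
      unfolding V \<phi>_def clinear_sum[OF clinear_slice] cinner_sum_left by (rule sum.swap)
    have "real n = cmod (\<phi> V)"
      by (simp add: \<phi>_V)
    also have "\<dots> \<le> (\<Sum>k<m. cmod (\<phi> (op_action (a k) (diamond d (u k) (v k)))))"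
      unfolding sum by (rule norm_sum)
    also have "\<dots> \<le> s"
      unfolding s \<phi>_def
      by (intro sum_mono diagonal_functional_le d norm_d a norm_e p q) simp
    finally show ?thesis .
  qed

  define a where "a \<xi> = (\<Sum>k<n. cinner \<xi> (d (e k) (e k)) *\<^sub>C e k)" for \<xi>
  define u where "u = (\<Sum>k<n. e k \<otimes> p k)"
  define v where "v = (\<Sum>k<n. e k \<otimes> q k)"
  have on: "cinner (d (e i) (e i)) (d (e k) (e k)) = (if i = k then 1 else 0)" for i k
    by (simp add: cinner_d e)
  have a: "bounded_clinear a" "onorm a \<le> 1"
    unfolding a_def
    by (rule bounded_clinear_partial_isometry onorm_partial_isometry_le; simp add: e on)+
  have lin: "clinear a"
    using a by (simp add: bounded_clinear_def)
  \<comment> \<open>A mixed product of \<open>e i\<close> and \<open>e k\<close> with i \<noteq> k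
    is orthogonal to every diagonal vector, so \<open>a\<close> kills it. This removes the cross
    terms of the diamond of \<open>u\<close> and \<open>v\<close>.\<close>
  have a_d: "a (d (e i) (e k)) = (if i = k then e k else 0)" if "k < n" for i k
  proof -
    have "a (d (e i) (e k)) = (\<Sum>l<n. if l = k then (if i = k then e k else 0) else 0)"
      unfolding a_def by (intro sum.cong refl) (auto simp: cinner_d e scaleC_one)
    then show ?thesis
      using that by simp
  qed
  have dia: "clinear (diamond d w)" "clinear (\<lambda>w. diamond d w z)"
    for w :: "('h, 'e) tensor" and z :: "('h, 'f) tensor"
    using cbilinear_diamond[OF d] by (auto simp: cbilinear_def)
  have "op_action a (diamond d u v) = (\<Sum>i<n. \<Sum>k<n. a (d (e i) (e k)) \<otimes> (p i \<otimes> q k))"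
    unfolding u_def v_def clinear_sum[OF dia(2)] clinear_sum[OF dia(1)]
      clinear_sum[OF clinear_op_action[OF lin]] diamond_pure[OF d] op_action_pure[OF lin]
    by (rule sum.swap)
  also have "\<dots> = (\<Sum>i<n. \<Sum>k<n. if i = k then e k \<otimes> (p k \<otimes> q k) else 0)"
    by (intro sum.cong refl) (auto simp: a_d)
  also have "\<dots> = V"
    by (simp add: V_def)
  finally have V: "op_action a (diamond d u v) = V" .
  have "cinner_norm (p k) = 1" "cinner_norm (q k) = 1" for k
    by (simp_all add: cinner_norm_def p q)
  then have "(cinner_norm u)\<^sup>2 = real n" "(cinner_norm v)\<^sup>2 = real n"
    by (simp_all add: u_def v_def e cinner_norm_sum_tensor_orthonormal)
  then have norms: "cinner_norm u = sqrt n" "cinner_norm v = sqrt n"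
    by (auto intro!: real_sqrt_unique[symmetric] cinner_norm_nonneg)
  \<comment> \<open>The representation of \<open>V\<close> with a single term, m = 1.\<close>
  have mem: "onorm a * cinner_norm u * cinner_norm v \<in> S"
    unfolding S_def mem_Collect_eq
    by (intro exI[of _ 1] exI[of _ "\<lambda>_. a"] exI[of _ "\<lambda>_. u"] exI[of _ "\<lambda>_. v"]) (simp add: a V)
  have "onorm a * cinner_norm u * cinner_norm v \<le> real n"
    using mult_right_mono[OF a(2), of "real n"] by (simp add: norms mult.assoc)
  \<comment> \<open>An infimum of reals is meaningful only for a nonempty set bounded below:
    \<open>mem\<close> supplies the former, \<open>lower\<close> the latter.\<close>
  then have "Inf S \<le> real n"
    using cInf_lower[OF mem bdd_belowI[OF lower]] by simp
  moreover have "real n \<le> Inf S"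
    using mem by (intro cInf_greatest lower) auto
  ultimately show ?thesis
    unfolding pl_tensor_norm_def V_def[symmetric] S_def[symmetric] by (rule antisym)
qed

text \<open>\<open>cinner_norm\<close> on tensors is the Hilbert tensor norm, and \<open>j\<close>
  followed by \<iota> realises the diamond product. Indices start at 0, so \<open>k < n\<close> runs
  over the first \<open>n\<close> unit sequences.\<close>

theorem proposition8p2:
  fixes j :: "('h::chilbert_space, 'h) tensor \<Rightarrow> 'k::chilbert_space"
    and \<iota> :: "'k \<Rightarrow> 'h"
    and e :: "nat \<Rightarrow> 'h"
    and n :: nat
  assumes separable: "separable_space (euclidean :: 'h topology)"
    and infinite_dimensional: "\<nexists>B :: 'h set. finite B \<and> complex_vector.span B = UNIV"
    and completion: "hilbert_completion j"
    and unitary: "unitary_map \<iota>"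
    and orthonormal: "\<And>i k. cinner (e i) (e k) = (if i = k then 1 else 0)"
  shows "pl_tensor_norm (\<lambda>\<xi> \<eta>. \<iota> (j (\<xi> \<otimes> \<eta>))) cinner_norm cinner_norm
    (\<Sum>k<n. e k \<otimes> (ell2_unit k \<otimes> ell2_unit k)) = real n"
proof (rule pl_tensor_norm_diagonal)
  have j: "clinear j" "cinner (j x) (j y) = cinner x y" for x y
    using completion by (auto simp: hilbert_completion_def)
  have \<iota>: "clinear \<iota>" "cinner (\<iota> x) (\<iota> y) = cinner x y" for x y
    using unitary by (auto simp: unitary_map_def)
  show "cbilinear (\<lambda>\<xi> \<eta>. \<iota> (j (\<xi> \<otimes> \<eta>)))"
    by (rule cbilinearI)
      (simp_all add: tensor_add_left tensor_add_right tensor_scaleC_left tensor_scaleC_right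
        clinear_add[OF j(1)] clinear_scaleC[OF j(1)] clinear_add[OF \<iota>(1)] clinear_scaleC[OF \<iota>(1)])
  show "cinner (\<iota> (j (\<xi> \<otimes> \<eta>))) (\<iota> (j (\<xi>' \<otimes> \<eta>'))) = cinner \<xi> \<xi>' * cinner \<eta> \<eta>'" for \<xi> \<eta> \<xi>' \<eta>'
    by (simp add: j \<iota> cinner_pure_tensor)
qed (fact orthonormal cinner_ell2_unit)+

end
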